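(* Let $X,Y$ be metric spaces, let $x_0,x_0'\in X$, $y_0,y_0'\in Y$ be points and let $R,R'\ge 0$ be real numbers. Suppose that (1) both $X$ and $Y$ are geodesic, or (2) $Y$ is visual from $y_0$ and visual from $y_0'$. Then $(X,x_0)\ast_R(Y,y_0)$ and $(X,x_0')\ast_{R'}(Y,y_0')$ are coarsely equivalent.
   Context: Metrics take only finite values. A subset $E\subseteq X\times X$ of the square of a metric space is an entourage if $\sup_{(x,y)\in E}d(x,y)<\infty$. A map $f:X\to Y$ between metric spaces is coarse if $(f\times f)(E)$ is an entourage for every entourage $E\subseteq X\times X$ and $f^{-1}(B)$ is bounded for every bounded $B\subseteq Y$. Maps $f,g:X\to Y$ are close if $\sup_{x\in X} d(f(x),g(x))<\infty$. A coarse map $f:X\to Y$ is a coarse equivalence if there is a coarse map $g:Y\to X$ with $f\circ g$ close to $\mathrm{id}_Y$ and $g\circ f$ close to $\mathrm{id}_X$; $X$ and $Y$ are coarsely equivalent if such an $f$ exists. The product $X\times Y$ carries the metric $d((x_1,y_1),(x_2,y_2))=\max(d(x_1,x_2),d(y_1,y_2))$. The asymptotic product with respect to $x_0\in X,y_0\in Y,R\ge 0$ is $$(X,x_0)\ast_R(Y,y_0)=\{(x,y)\in X\times Y: |d(x_0,x)-d(y_0,y)|\le R\}$$ with the metric restricted from $X\times Y$. A metric space $Y$ is visual from $y_0\in Y$ if it is geodesic and every geodesic segment $\gamma:[0,L]\to Y$ ($L\ge 0$, isometric embedding) with $\gamma(0)=y_0$ can be extended to a geodesic ray $[0,\infty)\to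 Y$ (isometric embedding). *)

theory Defs
  imports "HOL-Analysis.Analysis"
begin

text \<open>
  Metric spaces are values of the library type \<open>'a metric\<close>, i.e. a carrier \<open>mspace X\<close> with a
  real-valued distance \<open>mdist X\<close>. Maps are total HOL functions of which only the values on the
  carrier matter.
\<close>

subsection \<open>Coarse maps and coarse equivalence\<close>

text \<open>
  Finiteness of a supremum of distances is expressed by \<open>bdd_above\<close>, so the supremum of the
  empty set counts as finite.
\<close>

definition entourage :: "'a metric \<Rightarrow> ('a \<times> 'a) set \<Rightarrow> bool" where
  "entourage X E \<longleftrightarrow>
     E \<subseteq> mspace X \<times> mspace X \<and> bdd_above ((\<lambda>(x, y). mdist X x y) ` E)"

definition bounded_in :: "'a metric \<Rightarrow> 'a set \<Rightarrow> bool" where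
  "bounded_in X = Metric_space.mbounded (mspace X) (mdist X)"

definition coarse_map :: "'a metric \<Rightarrow> 'b metric \<Rightarrow> ('a \<Rightarrow> 'b) \<Rightarrow> bool" where
  "coarse_map X Y f \<longleftrightarrow>
     f \<in> mspace X \<rightarrow> mspace Y \<and>
     (\<forall>E. entourage X E \<longrightarrow> entourage Y (map_prod f f ` E)) \<and>
     (\<forall>B. bounded_in Y B \<longrightarrow> bounded_in X (f -` B \<inter> mspace X))"

definition close_maps :: "'a metric \<Rightarrow> 'b metric \<Rightarrow> ('a \<Rightarrow> 'b) \<Rightarrow> ('a \<Rightarrow> 'b) \<Rightarrow> bool" where
  "close_maps X Y f g \<longleftrightarrow> bdd_above ((\<lambda>x. mdist Y (f x) (g x)) ` mspace X)"

definition coarse_equivalence :: "'a metric \<Rightarrow> 'b metric \<Rightarrow> ('a \<Rightarrow> 'b) \<Rightarrow> bool" where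
  "coarse_equivalence X Y f \<longleftrightarrow>
     coarse_map X Y f \<and>
     (\<exists>g. coarse_map Y X g \<and> close_maps Y Y (f \<circ> g) id \<and> close_maps X X (g \<circ> f) id)"

definition coarsely_equivalent :: "'a metric \<Rightarrow> 'b metric \<Rightarrow> bool" where
  "coarsely_equivalent X Y \<longleftrightarrow> (\<exists>f. coarse_equivalence X Y f)"

subsection \<open>The maximum metric and the asymptotic product\<close>

text \<open>The library's \<open>prod_metric\<close> is the Euclidean product, hence a separate constant.\<close>

definition max_prod_metric :: "'a metric \<Rightarrow> 'b metric \<Rightarrow> ('a \<times> 'b) metric" where
  "max_prod_metric X Y =
     metric (mspace X \<times> mspace Y,
       \<lambda>(x1, y1) (x2, y2). max (mdist X x1 x2) (mdist Y y1 y2))"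

text \<open>
  The constructor \<open>metric\<close> is meaningful only for an actual metric space; this is that obligation.
\<close>

lemma Metric_space_max_prod:
  "Metric_space (mspace X \<times> mspace Y)
     (\<lambda>(x1, y1) (x2, y2). max (mdist X x1 x2) (mdist Y y1 y2))"
proof
  fix p q r
  assume "p \<in> mspace X \<times> mspace Y" "q \<in> mspace X \<times> mspace Y" "r \<in> mspace X \<times> mspace Y"
  then obtain x1 y1 x2 y2 x3 y3 where
    eq: "p = (x1, y1)" "q = (x2, y2)" "r = (x3, y3)" and
    X: "x1 \<in> mspace X" "x2 \<in> mspace X" "x3 \<in> mspace X" and
    Y: "y1 \<in> mspace Y" "y2 \<in> mspace Y" "y3 \<in> mspace Y"
    by auto
  show "(\<lambda>(x1, y1) (x2, y2). max (mdist X x1 x2) (mdist Y y1 y2)) p r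
      \<le> (\<lambda>(x1, y1) (x2, y2). max (mdist X x1 x2) (mdist Y y1 y2)) p q
       + (\<lambda>(x1, y1) (x2, y2). max (mdist X x1 x2) (mdist Y y1 y2)) q r"
    using mdist_triangle[OF X] mdist_triangle[OF Y] unfolding eq prod.case by linarith
next
  fix p q
  assume "p \<in> mspace X \<times> mspace Y" "q \<in> mspace X \<times> mspace Y"
  then obtain x1 y1 x2 y2 where
    eq: "p = (x1, y1)" "q = (x2, y2)" and
    X: "x1 \<in> mspace X" "x2 \<in> mspace X" and
    Y: "y1 \<in> mspace Y" "y2 \<in> mspace Y"
    by auto
  show "((\<lambda>(x1, y1) (x2, y2). max (mdist X x1 x2) (mdist Y y1 y2)) p q = 0) = (p = q)"
    using mdist_zero[OF X] mdist_zero[OF Y] mdist_nonneg[of X x1 x2] mdist_nonneg[of Y y1 y2]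
    unfolding eq prod.case prod.inject by linarith
qed (auto simp: mdist_commute le_max_iff_disj split: prod.splits)

lemma mspace_max_prod_metric [simp]:
  "mspace (max_prod_metric X Y) = mspace X \<times> mspace Y"
  unfolding max_prod_metric_def
  by (rule Metric_space.mspace_metric[OF Metric_space_max_prod])

lemma mdist_max_prod_metric [simp]:
  "mdist (max_prod_metric X Y) (x1, y1) (x2, y2) = max (mdist X x1 x2) (mdist Y y1 y2)"
  unfolding max_prod_metric_def
  by (simp add: Metric_space.mdist_metric[OF Metric_space_max_prod])

definition asymptotic_product ::
    "'a metric \<Rightarrow> 'a \<Rightarrow> real \<Rightarrow> 'b metric \<Rightarrow> 'b \<Rightarrow> ('a \<times> 'b) metric" where
  "asymptotic_product X x0 R Y y0 =
     submetric (max_prod_metric X Y)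
       {(x, y) \<in> mspace X \<times> mspace Y. \<bar>mdist X x0 x - mdist Y y0 y\<bar> \<le> R}"

subsection \<open>Geodesic and visual spaces\<close>

definition isometric_embedding :: "'a metric \<Rightarrow> 'b metric \<Rightarrow> ('a \<Rightarrow> 'b) \<Rightarrow> bool" where
  "isometric_embedding X Y f \<longleftrightarrow>
     f \<in> mspace X \<rightarrow> mspace Y \<and>
     (\<forall>x\<in>mspace X. \<forall>y\<in>mspace X. mdist Y (f x) (f y) = mdist X x y)"

definition geodesic_segment :: "'a metric \<Rightarrow> real \<Rightarrow> (real \<Rightarrow> 'a) \<Rightarrow> bool" where
  "geodesic_segment Y L \<gamma> \<longleftrightarrow>
     0 \<le> L \<and> isometric_embedding (submetric euclidean_metric {0..L}) Y \<gamma>"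

definition geodesic_ray :: "'a metric \<Rightarrow> (real \<Rightarrow> 'a) \<Rightarrow> bool" where
  "geodesic_ray Y \<rho> \<longleftrightarrow> isometric_embedding (submetric euclidean_metric {0..}) Y \<rho>"

definition geodesic_space :: "'a metric \<Rightarrow> bool" where
  "geodesic_space Y \<longleftrightarrow>
     (\<forall>x\<in>mspace Y. \<forall>y\<in>mspace Y. \<exists>L \<gamma>. geodesic_segment Y L \<gamma> \<and> \<gamma> 0 = x \<and> \<gamma> L = y)"

definition visual_from :: "'a metric \<Rightarrow> 'a \<Rightarrow> bool" where
  "visual_from Y y0 \<longleftrightarrow>
     geodesic_space Y \<and>
     (\<forall>L \<gamma>. geodesic_segment Y L \<gamma> \<and> \<gamma> 0 = y0 \<longrightarrow>
        (\<exists>\<rho>. geodesic_ray Y \<rho> \<and> (\<forall>t\<in>{0..L}. \<rho> t = \<gamma> t)))"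

end

theory Submission
  imports Defs
begin

text \<open>
  Any two subsets of a metric space at finite Hausdorff distance are coarsely equivalent: moving
  each point of one set to a nearby point of the other displaces points by a bounded amount, and
  such maps in the two directions are coarse and mutually inverse up to closeness. The two
  asymptotic products are subsets of the same space, the product with the maximum metric, so it
  suffices to bound their Hausdorff distance; no explicit map is ever needed.

  By the triangle inequality, replacing the base points costs at most the sum of their distances
  in the defining inequality. It therefore remains to move a point \<open>(x, y)\<close> with
  \<open>\<bar>d(x\<^sub>0, x) - d(y\<^sub>0, y)\<bar> \<le> S\<close> by at most \<open>S\<close> to a point whose coordinates are at equal distance
  from the base points; such a point lies in the asymptotic product for every nonnegative
  parameter. If both spaces are geodesic, one retracts the coordinate that is farther out along a
  geodesic towards its base point. If \<open>Y\<close> is visual, one always moves \<open>y\<close>, along a ray from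
  \<open>y\<^sub>0\<close> through \<open>y\<close>, inwards or outwards to radius \<open>d(x\<^sub>0, x)\<close>, and keeps \<open>x\<close> fixed.
\<close>

text \<open>
  Displacing all points by at most \<open>C\<close> changes distances by at most \<open>2 * C\<close> in either direction.
  The upper bound preserves entourages, the lower bound keeps preimages of bounded sets bounded.
\<close>

lemma coarse_map_bounded_displacement:
  assumes S: "S \<subseteq> mspace M" and T: "T \<subseteq> mspace M" and f: "f \<in> S \<rightarrow> T"
    and C: "\<And>s. s \<in> S \<Longrightarrow> mdist M s (f s) \<le> C"
  shows "coarse_map (submetric M S) (submetric M T) f"
proof -
  have [simp]: "S \<inter> mspace M = S" "T \<inter> mspace M = T"
    using S T by auto
  have expand: "mdist M (f s) (f t) \<le> mdist M s t + 2 * C"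
    and contract: "mdist M s t \<le> mdist M (f s) (f t) + 2 * C"
    if "s \<in> S" "t \<in> S" for s t
  proof -
    have m: "s \<in> mspace M" "t \<in> mspace M" "f s \<in> mspace M" "f t \<in> mspace M"
      using that f S T by auto
    show "mdist M (f s) (f t) \<le> mdist M s t + 2 * C"
      using mdist_triangle[OF m(3,1,4)] mdist_triangle[OF m(1,2,4)] C[OF that(1)] C[OF that(2)]
        mdist_commute[of M "f s" s] by linarith
    show "mdist M s t \<le> mdist M (f s) (f t) + 2 * C"
      using mdist_triangle[OF m(1,3,2)] mdist_triangle[OF m(3,4,2)] C[OF that(1)] C[OF that(2)]
        mdist_commute[of M "f t" t] by linarith
  qed
  have "entourage (submetric M T) (map_prod f f ` E)" if E: "entourage (submetric M S) E" for E
  proof -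
    have sub: "E \<subseteq> S \<times> S" and "bdd_above ((\<lambda>(x, y). mdist M x y) ` E)"
      using E by (simp_all add: entourage_def)
    then obtain K where K: "\<And>x y. (x, y) \<in> E \<Longrightarrow> mdist M x y \<le> K"
      by (force simp: bdd_above_def)
    have "mdist M (f x) (f y) \<le> K + 2 * C" if "(x, y) \<in> E" for x y
      using expand[of x y] K[OF that] that sub by fastforce
    then have "bdd_above ((\<lambda>(x, y). mdist M x y) ` map_prod f f ` E)"
      by (intro bdd_aboveI[of _ "K + 2 * C"]) auto
    moreover have "map_prod f f ` E \<subseteq> T \<times> T"
      using sub f by auto
    ultimately show ?thesis
      by (simp add: entourage_def)
  qed
  moreover have "bounded_in (submetric M S) (f -` B \<inter> S)"
    if B: "bounded_in (submetric M T) B" for B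
  proof -
    obtain K where K: "\<And>x y. x \<in> B \<Longrightarrow> y \<in> B \<Longrightarrow> mdist M x y \<le> K"
      using B unfolding bounded_in_def Metric_space.mbounded_alt[OF Metric_space_mspace_mdist]
      by auto
    have "mdist M x y \<le> K + 2 * C" if "x \<in> f -` B \<inter> S" "y \<in> f -` B \<inter> S" for x y
      using contract[of x y] K[of "f x" "f y"] that by auto
    then show ?thesis
      unfolding bounded_in_def Metric_space.mbounded_alt[OF Metric_space_mspace_mdist]
      by auto
  qed
  ultimately show ?thesis
    using f by (simp add: coarse_map_def)
qed

text \<open>
  Choosing nearby points gives maps both ways; a round trip displaces a point by at most \<open>2 * C\<close>.
\<close>

lemma coarsely_equivalent_finite_Hausdorff_distance:
  assumes S: "S \<subseteq> mspace M" and T: "T \<subseteq> mspace M"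
    and ST: "\<And>s. s \<in> S \<Longrightarrow> \<exists>t\<in>T. mdist M s t \<le> C"
    and TS: "\<And>t. t \<in> T \<Longrightarrow> \<exists>s\<in>S. mdist M t s \<le> C"
  shows "coarsely_equivalent (submetric M S) (submetric M T)"
proof -
  obtain f where f: "f \<in> S \<rightarrow> T" "\<And>s. s \<in> S \<Longrightarrow> mdist M s (f s) \<le> C"
    using ST by (metis Pi_I)
  obtain g where g: "g \<in> T \<rightarrow> S" "\<And>t. t \<in> T \<Longrightarrow> mdist M t (g t) \<le> C"
    using TS by (metis Pi_I)
  have close: "close_maps (submetric M U) (submetric M U) (k \<circ> h) id"
    if U: "U \<subseteq> mspace M" and V: "V \<subseteq> mspace M"
      and h: "h \<in> U \<rightarrow> V" "\<And>u. u \<in> U \<Longrightarrow> mdist M u (h u) \<le> C"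
      and k: "k \<in> V \<rightarrow> U" "\<And>v. v \<in> V \<Longrightarrow> mdist M v (k v) \<le> C" for U V h k
  proof -
    have "mdist M (k (h u)) u \<le> 2 * C" if "u \<in> U" for u
    proof -
      have "h u \<in> V" "k (h u) \<in> U"
        using that h(1) k(1) by auto
      then show ?thesis
        using mdist_triangle[of "k (h u)" M "h u" u] h(2)[OF that] k(2)[of "h u"] that U V
          mdist_commute[of M "k (h u)" "h u"] mdist_commute[of M "h u" u] by force
    qed
    then show ?thesis
      using U by (auto simp: close_maps_def intro!: bdd_aboveI[of _ "2 * C"])
  qed
  show ?thesis
    unfolding coarsely_equivalent_def coarse_equivalence_def
    using coarse_map_bounded_displacement[OF S T f] coarse_map_bounded_displacement[OF T S g]
      close[OF T S g f] close[OF S T f g] by blast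
qed

lemma geodesic_segment_dist:
  assumes "geodesic_segment Y L \<gamma>" "s \<in> {0..L}" "t \<in> {0..L}"
  shows "\<gamma> s \<in> mspace Y" "mdist Y (\<gamma> s) (\<gamma> t) = \<bar>s - t\<bar>"
  using assms by (auto simp: geodesic_segment_def isometric_embedding_def dist_real_def)

lemma geodesic_ray_dist:
  assumes "geodesic_ray Y \<rho>" "0 \<le> s" "0 \<le> t"
  shows "\<rho> s \<in> mspace Y" "mdist Y (\<rho> s) (\<rho> t) = \<bar>s - t\<bar>"
  using assms by (auto simp: geodesic_ray_def isometric_embedding_def dist_real_def)

lemma geodesic_segment_between:
  assumes "geodesic_space Y" "y\<^sub>0 \<in> mspace Y" "y \<in> mspace Y"
  obtains \<gamma> where "geodesic_segment Y (mdist Y y\<^sub>0 y) \<gamma>" "\<gamma> 0 = y\<^sub>0" "\<gamma> (mdist Y y\<^sub>0 y) = y"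
proof -
  obtain L \<gamma> where \<gamma>: "geodesic_segment Y L \<gamma>" "\<gamma> 0 = y\<^sub>0" "\<gamma> L = y"
    using assms unfolding geodesic_space_def by blast
  then have "0 \<le> L"
    by (simp add: geodesic_segment_def)
  then have "mdist Y y\<^sub>0 y = L"
    using geodesic_segment_dist(2)[OF \<gamma>(1), of 0 L] \<gamma>(2,3) by simp
  then show ?thesis
    using that \<gamma> by blast
qed

lemma geodesic_space_retract_to_radius:
  assumes "geodesic_space Y" "y\<^sub>0 \<in> mspace Y" "y \<in> mspace Y" "0 \<le> r" "r \<le> mdist Y y\<^sub>0 y"
  shows "\<exists>z\<in>mspace Y. mdist Y y\<^sub>0 z = r \<and> mdist Y y z = mdist Y y\<^sub>0 y - r"
proof -
  obtain \<gamma> where \<gamma>: "geodesic_segment Y (mdist Y y\<^sub>0 y) \<gamma>" "\<gamma> 0 = y\<^sub>0" "\<gamma> (mdist Y y\<^sub>0 y) = y"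
    using geodesic_segment_between[OF assms(1-3)] .
  show ?thesis
    using geodesic_segment_dist[OF \<gamma>(1), of r r] geodesic_segment_dist(2)[OF \<gamma>(1), of 0 r]
      geodesic_segment_dist(2)[OF \<gamma>(1), of "mdist Y y\<^sub>0 y" r] \<gamma>(2,3) assms(4,5)
    by (intro bexI[of _ "\<gamma> r"]) auto
qed

text \<open>
  A ray that starts at the base point and passes through \<open>y\<close> meets the sphere of every radius, the
  radii beyond \<open>y\<close> included, and its parametrization by arc length measures the displacement. A
  geodesic from the base point to \<open>y\<close> only reaches the radii up to that of \<open>y\<close>.
\<close>

lemma visual_from_move_to_radius:
  assumes "visual_from Y y\<^sub>0" "y\<^sub>0 \<in> mspace Y" "y \<in> mspace Y" "0 \<le> r"
  shows "\<exists>z\<in>mspace Y. mdist Y y\<^sub>0 z = r \<and> mdist Y y z = \<bar>mdist Y y\<^sub>0 y - r\<bar>"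
proof -
  have geo: "geodesic_space Y"
    using assms(1) by (simp add: visual_from_def)
  obtain \<gamma> where \<gamma>: "geodesic_segment Y (mdist Y y\<^sub>0 y) \<gamma>" "\<gamma> 0 = y\<^sub>0" "\<gamma> (mdist Y y\<^sub>0 y) = y"
    using geodesic_segment_between[OF geo assms(2,3)] .
  then obtain \<rho> where \<rho>: "geodesic_ray Y \<rho>" "\<forall>t\<in>{0..mdist Y y\<^sub>0 y}. \<rho> t = \<gamma> t"
    using assms(1) unfolding visual_from_def by blast
  then have "\<rho> 0 = y\<^sub>0" "\<rho> (mdist Y y\<^sub>0 y) = y"
    using \<gamma>(2,3) by simp_all
  then show ?thesis
    using geodesic_ray_dist[OF \<rho>(1), of r r] geodesic_ray_dist(2)[OF \<rho>(1), of 0 r]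
      geodesic_ray_dist(2)[OF \<rho>(1), of "mdist Y y\<^sub>0 y" r] assms(4)
    by (intro bexI[of _ "\<rho> r"]) auto
qed

text \<open>
  The defect in the defining inequality of the asymptotic product also bounds the distance to the
  points with no defect. Without rays one can only shorten a radius, so the coordinate to move
  depends on which radius is larger, and both spaces must be geodesic.
\<close>

lemma equalize_radii:
  assumes "geodesic_space X \<and> geodesic_space Y \<or> visual_from Y y\<^sub>0"
    and "x\<^sub>0 \<in> mspace X" "y\<^sub>0 \<in> mspace Y" "x \<in> mspace X" "y \<in> mspace Y"
  shows "\<exists>u\<in>mspace X. \<exists>v\<in>mspace Y. mdist X x\<^sub>0 u = mdist Y y\<^sub>0 v \<and>
    max (mdist X x u) (mdist Y y v) \<le> \<bar>mdist X x\<^sub>0 x - mdist Y y\<^sub>0 y\<bar>"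
proof -
  have refl: "mdist X x x = 0" "mdist Y y y = 0"
    using mdist_zero[OF assms(4,4)] mdist_zero[OF assms(5,5)] by simp_all
  show ?thesis
  proof (cases "visual_from Y y\<^sub>0")
    case True
    obtain v where "v \<in> mspace Y" "mdist Y y\<^sub>0 v = mdist X x\<^sub>0 x"
      "mdist Y y v = \<bar>mdist Y y\<^sub>0 y - mdist X x\<^sub>0 x\<bar>"
      using visual_from_move_to_radius[OF True assms(3,5), of "mdist X x\<^sub>0 x"] by auto
    then show ?thesis
      using assms(4) by (intro bexI[of _ x] bexI[of _ v]) (auto simp: refl)
  next
    case False
    then have X: "geodesic_space X" and Y: "geodesic_space Y"
      using assms(1) by auto
    show ?thesis
    proof (cases "mdist Y y\<^sub>0 y \<le> mdist X x\<^sub>0 x")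
      case True
      then obtain u where "u \<in> mspace X" "mdist X x\<^sub>0 u = mdist Y y\<^sub>0 y"
        "mdist X x u = mdist X x\<^sub>0 x - mdist Y y\<^sub>0 y"
        using geodesic_space_retract_to_radius[OF X assms(2,4), of "mdist Y y\<^sub>0 y"] by auto
      then show ?thesis
        using assms(5) True by (intro bexI[of _ u] bexI[of _ y]) (auto simp: refl)
    next
      case False
      then obtain v where "v \<in> mspace Y" "mdist Y y\<^sub>0 v = mdist X x\<^sub>0 x"
        "mdist Y y v = mdist Y y\<^sub>0 y - mdist X x\<^sub>0 x"
        using geodesic_space_retract_to_radius[OF Y assms(3,5), of "mdist X x\<^sub>0 x"] by auto
      then show ?thesis
        using assms(4) False by (intro bexI[of _ v] bexI[of _ x]) (auto simp: refl)
    qed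
  qed
qed

lemma radius_difference_change_base:
  assumes "x\<^sub>0 \<in> mspace X" "x\<^sub>0' \<in> mspace X" "x \<in> mspace X"
    and "y\<^sub>0 \<in> mspace Y" "y\<^sub>0' \<in> mspace Y" "y \<in> mspace Y"
  shows "\<bar>mdist X x\<^sub>0' x - mdist Y y\<^sub>0' y\<bar>
    \<le> \<bar>mdist X x\<^sub>0 x - mdist Y y\<^sub>0 y\<bar> + mdist X x\<^sub>0 x\<^sub>0' + mdist Y y\<^sub>0 y\<^sub>0'"
  using mdist_triangle[OF assms(1,2,3)] mdist_triangle[OF assms(2,1,3)]
    mdist_triangle[OF assms(4,5,6)] mdist_triangle[OF assms(5,4,6)]
    mdist_commute[of X x\<^sub>0 x\<^sub>0'] mdist_commute[of Y y\<^sub>0 y\<^sub>0']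
  by linarith

text \<open>
  Half of the bound on the Hausdorff distance; the other half is the same statement with the roles
  of the base points and of \<open>R\<close> and \<open>R'\<close> exchanged.
\<close>

lemma asymptotic_product_near:
  assumes "geodesic_space X \<and> geodesic_space Y \<or> visual_from Y y\<^sub>0'"
    and "x\<^sub>0 \<in> mspace X" "x\<^sub>0' \<in> mspace X" "y\<^sub>0 \<in> mspace Y" "y\<^sub>0' \<in> mspace Y" "0 \<le> R'"
    and p: "p \<in> {(x, y) \<in> mspace X \<times> mspace Y. \<bar>mdist X x\<^sub>0 x - mdist Y y\<^sub>0 y\<bar> \<le> R}"
  shows "\<exists>q \<in> {(x, y) \<in> mspace X \<times> mspace Y. \<bar>mdist X x\<^sub>0' x - mdist Y y\<^sub>0' y\<bar> \<le> R'}.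
    mdist (max_prod_metric X Y) p q \<le> R + mdist X x\<^sub>0 x\<^sub>0' + mdist Y y\<^sub>0 y\<^sub>0'"
proof -
  obtain x y where xy: "p = (x, y)" "x \<in> mspace X" "y \<in> mspace Y"
    "\<bar>mdist X x\<^sub>0 x - mdist Y y\<^sub>0 y\<bar> \<le> R"
    using p by auto
  obtain u v where "u \<in> mspace X" "v \<in> mspace Y" "mdist X x\<^sub>0' u = mdist Y y\<^sub>0' v"
    and "max (mdist X x u) (mdist Y y v) \<le> \<bar>mdist X x\<^sub>0' x - mdist Y y\<^sub>0' y\<bar>"
    using equalize_radii[OF assms(1,3,5) xy(2,3)] by blast
  moreover have "\<bar>mdist X x\<^sub>0' x - mdist Y y\<^sub>0' y\<bar> \<le> R + mdist X x\<^sub>0 x\<^sub>0' + mdist Y y\<^sub>0 y\<^sub>0'"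
    using radius_difference_change_base[OF assms(2,3) xy(2) assms(4,5) xy(3)] xy(4) by linarith
  ultimately show ?thesis
    using xy(1) assms(6) by (intro bexI[of _ "(u, v)"]) auto
qed

theorem proposition13:
  fixes X :: "'a metric" and Y :: "'b metric"
    and x\<^sub>0 x\<^sub>0' :: 'a and y\<^sub>0 y\<^sub>0' :: 'b and R R' :: real
  assumes "x\<^sub>0 \<in> mspace X" and "x\<^sub>0' \<in> mspace X"
    and "y\<^sub>0 \<in> mspace Y" and "y\<^sub>0' \<in> mspace Y"
    and "0 \<le> R" and "0 \<le> R'"
    and "geodesic_space X \<and> geodesic_space Y \<or> visual_from Y y\<^sub>0 \<and> visual_from Y y\<^sub>0'"
  shows "coarsely_equivalent (asymptotic_product X x\<^sub>0 R Y y\<^sub>0) (asymptotic_product X x\<^sub>0' R' Y y\<^sub>0')"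
proof -
  let ?D = "mdist X x\<^sub>0 x\<^sub>0' + mdist Y y\<^sub>0 y\<^sub>0'"
  have y0: "geodesic_space X \<and> geodesic_space Y \<or> visual_from Y y\<^sub>0"
    and y0': "geodesic_space X \<and> geodesic_space Y \<or> visual_from Y y\<^sub>0'"
    using assms(7) by auto
  show ?thesis
    unfolding asymptotic_product_def
  proof (rule coarsely_equivalent_finite_Hausdorff_distance[where C = "max R R' + ?D"],
      goal_cases)
    case (3 p)
    show ?case
      using asymptotic_product_near[OF y0' assms(1-4,6) 3] by force
  next
    case (4 p)
    show ?case
      using asymptotic_product_near[OF y0 assms(2,1,4,3,5) 4]
        mdist_commute[of X x\<^sub>0 x\<^sub>0'] mdist_commute[of Y y\<^sub>0 y\<^sub>0'] by force
  qed auto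
qed

end
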